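(* Let $\mathscr{A}$ be a real tensor of order $k$ and dimension $n$, let $\{V_1,\dots,V_m\}$ be an equitable partition of $[n]$ corresponding to $\mathscr{A}$, and let $X$ and $\mathscr{B}$ be the characteristic matrix of this partition and the (equitable) quotient tensor of $\mathscr{A}$ corresponding to it, respectively. If $y\in\mathbb{R}^m$ is an eigenvector of $\mathscr{B}$ corresponding to the $H$-eigenvalue $\lambda$, then $Xy$ is an eigenvector of $\mathscr{A}$ corresponding to $\lambda$.
   Context: For an order $k$ dimension $n$ tensor $\mathscr{T}=(t_{i_1\cdots i_k})$ and $x\in\mathbb{R}^n$, $\mathscr{T}x\in\mathbb{R}^n$ has entries $(\mathscr{T}x)_i=\sum_{i_2,\dots,i_k\in[n]}t_{ii_2\cdots i_k}x_{i_2}\cdots x_{i_k}$, and $x^{[k-1]}=(x_1^{k-1},\dots,x_n^{k-1})^T$. A real number $\lambda$ is an $H$-eigenvalue of $\mathscr{T}$ with eigenvector $x$ if $x\in\mathbb{R}^n$ is nonzero and $\mathscr{T}x=\lambda x^{[k-1]}$. A partition $\{V_1,\dots,V_m\}$ of $[n]$ consists of nonempty pairwise disjoint sets with union $[n]$; its characteristic matrix is the $n\times m$ matrix $X$ with $x_{ij}=1$ if $i\in V_j$ and $0$ otherwise. The quotient tensor of $\mathscr{A}=(a_{i_1\cdots i_k})$ is the order $k$ dimension $m$ tensor $\mathscr{B}$ with $b_{ii_2\cdots i_k}=\frac{1}{|V_i|}\sum_{j\in V_i}\sum_{j_2\in V_{i_2},\dots,j_k\in V_{i_k}}a_{jj_2\cdots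 j_k}$; the partition is equitable corresponding to $\mathscr{A}$ if $\sum_{j_2\in V_{i_2},\dots,j_k\in V_{i_k}}a_{jj_2\cdots j_k}=b_{ii_2\cdots i_k}$ for all $i,i_2,\dots,i_k\in[m]$ and all $j\in V_i$. *)

theory Defs
  imports "HOL-Analysis.Analysis"
begin

text \<open>
  The index set of size \<open>n\<close> is a finite type \<open>'n\<close>. A tensor of order \<open>k\<close> is a function on
  index lists; only its values on lists of length \<open>k\<close> are its entries, and the notions below
  that take \<open>k\<close> as an argument never look at any other list (for \<open>k \<ge> 1\<close>).
\<close>

type_synonym 'n tensor = "'n list \<Rightarrow> real"

definition tensor_apply :: "nat \<Rightarrow> 'n::finite tensor \<Rightarrow> real ^ 'n \<Rightarrow> real ^ 'n" where
  "tensor_apply k T x = (\<chi> i. \<Sum>js | length js = k - 1. T (i # js) * (\<Prod>j\<leftarrow>js. x $ j))"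

definition entrywise_power :: "real ^ 'n \<Rightarrow> nat \<Rightarrow> real ^ 'n" where
  "entrywise_power x p = (\<chi> i. (x $ i) ^ p)"

definition H_eigenvector :: "nat \<Rightarrow> 'n::finite tensor \<Rightarrow> real \<Rightarrow> real ^ 'n \<Rightarrow> bool" where
  "H_eigenvector k T lam x \<longleftrightarrow>
     x \<noteq> 0 \<and> tensor_apply k T x = lam *\<^sub>R entrywise_power x (k - 1)"

definition indexed_partition :: "('m \<Rightarrow> 'n set) \<Rightarrow> bool" where
  "indexed_partition V \<longleftrightarrow>
     (\<forall>j. V j \<noteq> {}) \<and> disjoint_family V \<and> (\<Union>j. V j) = UNIV"

definition characteristic_matrix :: "('m::finite \<Rightarrow> 'n::finite set) \<Rightarrow> real ^ 'm ^ 'n" where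
  "characteristic_matrix V = (\<chi> i j. if i \<in> V j then 1 else 0)"

text \<open>
  For \<open>is = [i\<^sub>2, \<dots>, i\<^sub>k]\<close>, the set \<open>listset (map V is)\<close> consists of the lists
  \<open>[j\<^sub>2, \<dots>, j\<^sub>k]\<close> with each \<open>j\<^sub>r\<close> in \<open>V i\<^sub>r\<close>. The value on the empty list is a dummy.
\<close>

fun quotient_tensor :: "('m \<Rightarrow> 'n set) \<Rightarrow> 'n tensor \<Rightarrow> 'm tensor" where
  "quotient_tensor V A [] = 0"
| "quotient_tensor V A (i # is) =
     1 / real (card (V i)) * (\<Sum>j\<in>V i. \<Sum>js\<in>listset (map V is). A (j # js))"

definition equitable_partition :: "nat \<Rightarrow> ('m \<Rightarrow> 'n set) \<Rightarrow> 'n tensor \<Rightarrow> bool" where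
  "equitable_partition k V A \<longleftrightarrow>
     indexed_partition V \<and>
     (\<forall>i is. length is = k - 1 \<longrightarrow>
        (\<forall>j\<in>V i. (\<Sum>js\<in>listset (map V is). A (j # js)) = quotient_tensor V A (i # is)))"

end

theory Submission
  imports Defs
begin

text \<open>
  Let \<open>c\<close> send each index to its class, so that \<open>j \<in> V i \<longleftrightarrow> c j = i\<close> and \<open>(X y)\<^sub>j = y\<^bsub>c j\<^esub>\<close>.
  Grouping the index lists \<open>js\<close> in \<open>(A (X y))\<^sub>j\<close> by \<open>map c js\<close>, equitability turns the inner
  sums into entries of the quotient tensor, and \<open>(A (X y))\<^sub>j = (B y)\<^bsub>c j\<^esub>\<close> for all vectors \<open>y\<close>.
\<close>

text \<open>Covering gives each index a class and disjointness makes it unique, so \<open>c\<close>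
  is well defined. Surjectivity of \<open>c\<close> is exactly nonemptiness of the classes.\<close>

lemma indexed_partition_class_map:
  assumes "indexed_partition V"
  obtains c where "\<And>i j. j \<in> V i \<longleftrightarrow> c j = i" and "surj c"
proof
  have ex: "\<exists>i. j \<in> V i" for j
    using assms unfolding indexed_partition_def by blast
  have uniq: "i = i'" if "j \<in> V i" "j \<in> V i'" for i i' j
    using assms that unfolding indexed_partition_def disjoint_family_on_def by blast
  show mem: "j \<in> V i \<longleftrightarrow> (THE i. j \<in> V i) = i" for i j
    using ex[of j] uniq by (metis the_equality)
  show "surj (\<lambda>j. THE i. j \<in> V i)"
    unfolding surj_def using assms mem unfolding indexed_partition_def by (metis ex_in_conv)
qed

text \<open>Rewrites the products of classes in the quotient tensor as fibres of
  \<open>map c\<close>, the form in which sums can be grouped.\<close>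

lemma listset_map_class:
  assumes "\<And>i j. j \<in> V i \<longleftrightarrow> c j = i"
  shows "listset (map V is) = {js. map c js = is}"
  by (induction "is") (auto simp: set_Cons_def assms map_eq_Cons_conv)

lemma characteristic_matrix_mult:
  assumes "\<And>i j. j \<in> V i \<longleftrightarrow> c j = i"
  shows "(characteristic_matrix V *v y) $ j = y $ c j"
  by (simp add: characteristic_matrix_def matrix_vector_mult_def assms if_distrib[of "\<lambda>t. t * _"] cong: if_cong)

lemma tensor_apply_characteristic_matrix:
  fixes V :: "'m::finite \<Rightarrow> 'n::finite set"
  assumes eq: "equitable_partition k V A" and c: "\<And>i j. j \<in> V i \<longleftrightarrow> c j = i"
  shows "tensor_apply k A (characteristic_matrix V *v y) $ j
    = tensor_apply k (quotient_tensor V A) y $ c j"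
proof -
  let ?J = "{js::'n list. length js = k - 1}" and ?I = "{is::'m list. length is = k - 1}"
  have fin: "finite ?J" "finite ?I"
    using finite_lists_length_eq[of "UNIV :: 'n set"] finite_lists_length_eq[of "UNIV :: 'm set"]
    by simp_all
  have "tensor_apply k A (characteristic_matrix V *v y) $ j
      = (\<Sum>js\<in>?J. A (j # js) * (\<Prod>i\<leftarrow>map c js. y $ i))"
    by (simp add: tensor_apply_def characteristic_matrix_mult[OF c] o_def)
  \<comment> \<open>Since \<open>map c\<close> preserves length, it sends \<open>?J\<close> into
    \<open>?I\<close>, so its fibres over \<open>?I\<close> partition \<open>?J\<close>.\<close>
  also have "\<dots> = (\<Sum>is\<in>?I. \<Sum>js | js \<in> ?J \<and> map c js = is. A (j # js) * (\<Prod>i\<leftarrow>map c js. y $ i))"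
    by (rule sum.group[symmetric]) (use fin in auto)
  also have "\<dots> = (\<Sum>is\<in>?I. quotient_tensor V A (c j # is) * (\<Prod>i\<leftarrow>is. y $ i))"
  proof (rule sum.cong[OF refl])
    fix "is" assume "is": "is \<in> ?I"
    \<comment> \<open>On the fibre over \<open>is\<close> the length condition is automatic, and the
      monomial depends only on \<open>is\<close>, so it factors out.\<close>
    have "(\<Sum>js | js \<in> ?J \<and> map c js = is. A (j # js) * (\<Prod>i\<leftarrow>map c js. y $ i))
        = (\<Sum>js\<in>listset (map V is). A (j # js) * (\<Prod>i\<leftarrow>is. y $ i))"
      unfolding listset_map_class[OF c] using "is" by (intro sum.cong) auto
    also have "\<dots> = (\<Sum>js\<in>listset (map V is). A (j # js)) * (\<Prod>i\<leftarrow>is. y $ i)"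
      by (simp add: sum_distrib_right)
    \<comment> \<open>Equitability, applied to \<open>j\<close> as a member of its own class
      \<open>V (c j)\<close>.\<close>
    also have "(\<Sum>js\<in>listset (map V is). A (j # js)) = quotient_tensor V A (c j # is)"
      using eq "is" c unfolding equitable_partition_def by blast
    finally show "(\<Sum>js | js \<in> ?J \<and> map c js = is. A (j # js) * (\<Prod>i\<leftarrow>map c js. y $ i))
        = quotient_tensor V A (c j # is) * (\<Prod>i\<leftarrow>is. y $ i)" .
  qed
  finally show ?thesis
    by (simp add: tensor_apply_def)
qed

theorem theorem3p3:
  fixes k :: nat
    and A :: "'n::finite tensor"
    and V :: "'m::finite \<Rightarrow> 'n set"
    and X :: "real ^ 'm ^ 'n"
    and B :: "'m tensor"
    and y :: "real ^ 'm"
    and lam :: real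
  assumes "k \<ge> 1"
    and "equitable_partition k V A"
    and "X = characteristic_matrix V"
    and "B = quotient_tensor V A"
    and "H_eigenvector k B lam y"
  shows "H_eigenvector k A lam (X *v y)"
proof -
  obtain c where c: "\<And>i j. j \<in> V i \<longleftrightarrow> c j = i" and surj: "surj c"
    using indexed_partition_class_map assms(2) unfolding equitable_partition_def by metis
  have Xy: "(X *v y) $ j = y $ c j" for j
    using characteristic_matrix_mult[OF c] assms(3) by simp
  have "X *v y \<noteq> 0"
  proof -
    obtain i where "y $ i \<noteq> 0"
      using assms(5) by (auto simp: H_eigenvector_def vec_eq_iff)
    \<comment> \<open>Some \<open>j\<close> has \<open>c j = i\<close>, so the nonzero entry of
      \<open>y\<close> at \<open>i\<close> reappears in \<open>X *v y\<close> at
      \<open>j\<close>.\<close>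
    then show ?thesis
      using surj Xy by (metis surjD zero_index)
  qed
  \<comment> \<open>Entry \<open>j\<close> of this equation is entry \<open>c j\<close> of the
    eigenvalue equation for \<open>B\<close> and \<open>y\<close>.\<close>
  moreover have "tensor_apply k A (X *v y) = lam *\<^sub>R entrywise_power (X *v y) (k - 1)"
    using assms(5) tensor_apply_characteristic_matrix[OF assms(2) c, of y]
    by (simp add: vec_eq_iff H_eigenvector_def entrywise_power_def Xy flip: assms(3,4))
  ultimately show ?thesis
    by (simp add: H_eigenvector_def)
qed

end
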